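(* Let $E(\hat\Phi)=F(\hat\Phi)+\sum_{j=1}^sG_j(\hat{\boldsymbol\phi}_j)$ be the discretized energy function of the coupled-mode Swift–Hohenberg model (defined in the context). Then any limit point $\hat\Phi^*$ of $\{\hat\Phi^k\}$ is a critical point of $E$, i.e. $\nabla E(\hat\Phi^* )=0$, if the sequence $\{\hat\Phi^k\}$ generated by the AB-BPG-$K$ method (described in the context) satisfies one of the following conditions: 1. $K=2$ and $\{\hat\Phi^k\}$ is bounded; 2. $K=4$.
   Context: **Discretized energy.** Fix integers $s\ge1$ (components), $1\le d\le m$, a projection matrix $\mathcal{P}\in\mathbb{R}^{d\times m}$ with rationally independent columns, an invertible $\mathbf{B}\in\mathbb{R}^{m\times m}$, length scales $q_j>0$, even integers $N_{l,j}$ and index sets $\Lambda_j=\{\mathbf{h}\in\mathbb{Z}^m:|h_l|\le N_{l,j}/2,\ l=1,\dots,m\}$. The unknown $\hat{\boldsymbol\phi}_j=(\hat\phi_j(\mathbf{h}))_{\mathbf{h}\in\Lambda_j}\in\mathbb{C}^{N_j}$, $N_j=\prod_l(N_{l,j}+1)$, is the vector of truncated Fourier coefficients of the $j$-th order parameter $\phi_j(\mathbf{r})=\sum_{\mathbf{h}}\hat\phi_j(\mathbf{h})e^{i(\mathcal{P}\mathbf{B}\mathbf{h})^\top\mathbf{r}}$. Write $\hat\Phi=(\hat{\boldsymbol\phi}_1,\dots,\hat{\boldsymbol\phi}_s)\in\mathbb{C}^{N}$, $N=\sum_jN_j$. Set $$G_j(\hat{\boldsymbol\phi}_j)=\tfrac12\langle\hat{\boldsymbol\phi}_j,\mathcal{D}_j\hat{\boldsymbol\phi}_j\rangle,\qquad(\mathcal{D}_j)_{\mathbf{h}}=[q_j^2-(\mathcal{P}\mathbf{B}\mathbf{h})^\top(\mathcal{P}\mathbf{B}\mathbf{h})]^2$$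 ($\mathcal{D}_j$ diagonal), and $$F(\hat\Phi)=\sum_{(i_1,\dots,i_s)}\tau_{i_1,\dots,i_s}\sum_{\sum_{j,k}\mathbf{h}_{j,k}=0}\ \prod_{j=1}^s\prod_{k=1}^{i_j}\hat\phi_j(\mathbf{h}_{j,k}),$$ where the outer sum is over $(i_1,\dots,i_s)\in\mathbb{N}^s$ with $1\le\sum_ji_j\le n$ for a fixed $n\le4$, the $\tau_{i_1,\dots,i_s}$ are interaction coefficients, and the inner sum is over $\mathbf{h}_{j,k}\in\Lambda_j$ ($1\le j\le s$, $1\le k\le i_j$). $F$ is taken to be coercive: $F(\hat\Phi)\to+\infty$ as $\hat\Phi\to\infty$. The problem is to minimize $E$ subject to $\hat{\boldsymbol\phi}_j\in\mathcal{S}_j=\{\hat{\boldsymbol\phi}\in\mathbb{C}^{N_j}:e_1^\top\hat{\boldsymbol\phi}=0\}$ (mass conservation; $e_1$ is the first coordinate vector, corresponding to the coefficient of $\mathbf{h}=\mathbf{0}$), and $\mathcal{P}_1=I-e_1e_1^\top$ is the projection onto $\mathcal{S}_j$. $\nabla_j$ is the partial gradient in block $j$; $(\mathbf{u},\hat{\boldsymbol\phi}_{\neq j})$ is $\hat\Phi$ with block $j$ replaced by $\mathbf{u}$; $[a]^+=\max\{0,a\}$. **AB-BPG-$K$ method** ($K\in\{2,4\}$). Parameters: $\sigma\ge\eta>0$, $\bar w>0$, an integer $M\ge0$, $\varsigma\in(0,1)$, $\alpha_0,\alpha_{\min},\alpha_{\max}>0$, and for $K=4$ constants $a,b>0$.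 Start with $\hat\Phi^{-1}=\hat\Phi^0\in\prod_j\mathcal{S}_j$, $w_0=0$. At iteration $k=0,1,\dots$: 1. Pick $i=b_k\in\{1,\dots,s\}$ in a deterministic or random manner. 2. Set $\hat{\boldsymbol\psi}^k=(1+w_k)\hat{\boldsymbol\phi}_i^k-w_k\hat{\boldsymbol\phi}_i^{\mathrm{prev}}$, where $\hat{\boldsymbol\phi}_i^{\mathrm{prev}}$ is the value of block $i$ before it was updated to $\hat{\boldsymbol\phi}_i^k$ (the initial value if there was no update). 3. For $\alpha>0$ define $\mathbf{z}^k(\alpha)$ by: if $K=2$, $\mathbf{z}^k(\alpha)=(\alpha\mathcal{D}_i+I)^{-1}(\hat{\boldsymbol\psi}^k-\alpha\mathcal{P}_1\nabla_iF(\hat{\boldsymbol\psi}^k,\hat{\boldsymbol\phi}_{\neq i}^k))$; if $K=4$, $\mathbf{z}^k(\alpha)=[\alpha\mathcal{D}_i+(ap^*+b)I]^{-1}(\nabla h(\hat{\boldsymbol\psi}^k)-\alpha\mathcal{P}_1\nabla_iF(\hat{\boldsymbol\psi}^k,\hat{\boldsymbol\phi}_{\neq i}^k))$ with $h(\mathbf{x})=\frac a4\|\mathbf{x}\|^4+\frac b2\|\mathbf{x}\|^2+1$ and $p^*$ the fixed point of $p=\|[\alpha\mathcal{D}_i+(ap+b)I]^{-1}(\nabla h(\hat{\boldsymbol\psi}^k)-\alpha\mathcal{P}_1\nabla_iF(\hat{\boldsymbol\psi}^k,\hat{\boldsymbol\phi}_{\neq i}^k))\|^2$. 4. Let $m_k=\operatorname{argmax}_{[k-M]^+\le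 j\le k}E(\hat\Phi^j)$. Initialize $\alpha=\alpha_0$ if $w_k=0$, otherwise $\alpha=\langle u,u\rangle/\langle u,v\rangle$ or $\langle v,u\rangle/\langle v,v\rangle$ with $u=\hat{\boldsymbol\psi}^k-\hat{\boldsymbol\phi}_i^k$, $v=\nabla_iF(\hat{\boldsymbol\psi}^k,\hat{\boldsymbol\phi}_{\neq i}^k)-\nabla_iF(\hat\Phi^k)$. Take the smallest $\ell\ge0$ such that, with $\mathbf{z}=\mathbf{z}^k(\varsigma^\ell\alpha)$ and $\varsigma^\ell\alpha\ge\alpha_{\min}$, $\max(E(\hat{\boldsymbol\psi}^k,\hat{\boldsymbol\phi}_{\neq i}^k),E(\hat\Phi^{m_k}))-E(\mathbf{z},\hat{\boldsymbol\phi}_{\neq i}^k)\ge\eta\|\hat{\boldsymbol\psi}^k-\mathbf{z}\|^2$; set $\alpha_k=\max(\min(\varsigma^\ell\alpha,\alpha_{\max}),\alpha_{\min})$ and $\mathbf{z}^k=\mathbf{z}^k(\alpha_k)$. 5. If $E(\hat\Phi^{m_k})-E(\mathbf{z}^k,\hat{\boldsymbol\phi}_{\neq i}^k)\ge\sigma\|\hat{\boldsymbol\phi}_i^k-\mathbf{z}^k\|^2$, set $\hat{\boldsymbol\phi}_i^{k+1}=\mathbf{z}^k$, leave the other blocks unchanged, and choose $w_{k+1}\in[0,\bar w]$. Otherwise restart by setting $\hat\Phi^{k+1}=\hat\Phi^k$, $w_{k+1}=0$. **Block selection rule (standing).** Within any $T\ge s$ consecutive iterations each block should be updated at least once, i.e.,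 for any $k$, $\{1,\dots,s\}\subseteq\{b_k,b_{k+1},\dots,b_{k+T}\}$.
   Formalization: Each block must be actually updated (Step 5 accepted) in every window, not merely selected; critical means P_1∇_jE=0 for all j on the feasible space, not ∇E=0; order parameters are real fields (φ̂(-h) conjugate to φ̂(h)), with coercivity and initial value there, and the τ are real. *)

theory Defs
  imports "HOL-Analysis.Analysis"
begin

section \<open>The discretized coupled-mode Swift--Hohenberg energy\<close>

text \<open>
  The components, the coordinates of the superspace and the coordinates of the physical space are
  indexed by finite types \<open>'s\<close>, \<open>'m\<close>, \<open>'d\<close>. The number \<open>N\<close> of Fourier coefficients depends on the
  truncation, so \<open>\<complex>\<^sup>N\<close> is \<open>complex ^ 'n\<close> together with an enumeration \<open>sh_idx\<close> which is required (in
  \<open>sh_model\<close>) to be a bijection of \<open>'n\<close> onto all pairs \<open>(j, h)\<close> with \<open>h\<close> in the truncated index set of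
  component \<open>j\<close>. A vector of a single block \<open>j\<close> is represented by the element of \<open>complex ^ 'n\<close> that
  is supported on block \<open>j\<close>; norms and inner products are unaffected.
\<close>

record ('s, 'm, 'd, 'n) sh_data =
  sh_P :: "real ^ 'm::finite ^ 'd::finite"
  sh_B :: "real ^ 'm ^ 'm"
  sh_q :: "'s \<Rightarrow> real"
  sh_N :: "'s \<Rightarrow> 'm \<Rightarrow> nat"
  sh_n :: nat
  sh_tau :: "('s \<Rightarrow> nat) \<Rightarrow> real"
  sh_idx :: "'n::finite \<Rightarrow> 's::finite \<times> (int ^ 'm)"

definition Lam :: "('s::finite, 'm::finite, 'd::finite, 'n::finite) sh_data \<Rightarrow> 's \<Rightarrow> (int ^ 'm) set" where
  "Lam S j = {h. \<forall>l. \<bar>h $ l\<bar> \<le> int (sh_N S j l div 2)}"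

definition coef :: "('s::finite, 'm::finite, 'd::finite, 'n::finite) sh_data
    \<Rightarrow> complex ^ 'n \<Rightarrow> 's \<Rightarrow> int ^ 'm \<Rightarrow> complex" where
  "coef S x j h = x $ inv (sh_idx S) (j, h)"

definition blk :: "('s::finite, 'm::finite, 'd::finite, 'n::finite) sh_data
    \<Rightarrow> 's \<Rightarrow> complex ^ 'n \<Rightarrow> complex ^ 'n" where
  "blk S j x = (\<chi> p. if fst (sh_idx S p) = j then x $ p else 0)"

text \<open>\<open>upd S j u x\<close> is \<open>(u, x\<^bsub>\<noteq>j\<^esub>)\<close>, the vector \<open>x\<close> with its block \<open>j\<close> replaced by that of \<open>u\<close>.\<close>

definition upd :: "('s::finite, 'm::finite, 'd::finite, 'n::finite) sh_data
    \<Rightarrow> 's \<Rightarrow> complex ^ 'n \<Rightarrow> complex ^ 'n \<Rightarrow> complex ^ 'n" where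
  "upd S j u x = (\<chi> p. if fst (sh_idx S p) = j then u $ p else x $ p)"

text \<open>The entries and the action of the diagonal operator \<open>\<D>\<^sub>j\<close>.\<close>

definition Dentry :: "('s::finite, 'm::finite, 'd::finite, 'n::finite) sh_data
    \<Rightarrow> 's \<Rightarrow> int ^ 'm \<Rightarrow> real" where
  "Dentry S j h =
     (let g = sh_P S *v (sh_B S *v (\<chi> l. of_int (h $ l))) in ((sh_q S j)\<^sup>2 - g \<bullet> g)\<^sup>2)"

definition Dop :: "('s::finite, 'm::finite, 'd::finite, 'n::finite) sh_data
    \<Rightarrow> 's \<Rightarrow> complex ^ 'n \<Rightarrow> complex ^ 'n" where
  "Dop S j x = (\<chi> p. if fst (sh_idx S p) = j
                       then of_real (Dentry S j (snd (sh_idx S p))) * x $ p else 0)"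

definition G_en :: "('s::finite, 'm::finite, 'd::finite, 'n::finite) sh_data
    \<Rightarrow> 's \<Rightarrow> complex ^ 'n \<Rightarrow> real" where
  "G_en S j x = (blk S j x \<bullet> Dop S j (blk S j x)) / 2"

definition slots :: "('s \<Rightarrow> nat) \<Rightarrow> ('s \<times> nat) set" where
  "slots i = (SIGMA j:UNIV. {1..i j})"

definition freqs :: "('s::finite, 'm::finite, 'd::finite, 'n::finite) sh_data
    \<Rightarrow> ('s \<Rightarrow> nat) \<Rightarrow> ('s \<times> nat \<Rightarrow> int ^ 'm) set" where
  "freqs S i = {H \<in> PiE (slots i) (\<lambda>(j, k). Lam S j). (\<Sum>p\<in>slots i. H p) = 0}"

definition F_cx :: "('s::finite, 'm::finite, 'd::finite, 'n::finite) sh_data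
    \<Rightarrow> complex ^ 'n \<Rightarrow> complex" where
  "F_cx S x =
     (\<Sum>i\<in>{i. 1 \<le> (\<Sum>j\<in>UNIV. i j) \<and> (\<Sum>j\<in>UNIV. i j) \<le> sh_n S}.
        of_real (sh_tau S i) *
          (\<Sum>H\<in>freqs S i. \<Prod>j\<in>UNIV. \<Prod>k=1..i j. coef S x j (H (j, k))))"

text \<open>
  Coefficient vectors of real-valued order parameters. On these \<open>F_cx\<close> is real (lemma
  \<open>F_cx_real\<close> below), so taking the real part only fixes a real-valued extension to all of
  \<open>complex ^ 'n\<close>. Since \<open>F_cx\<close> is holomorphic, the gradient of this extension with respect to the
  real inner product \<open>Re \<langle>x, y\<rangle>\<close> is, at such vectors, itself the coefficient vector of a
  real-valued field, i.e. it is also the gradient within the space of these vectors.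
\<close>

definition real_fields :: "('s::finite, 'm::finite, 'd::finite, 'n::finite) sh_data
    \<Rightarrow> (complex ^ 'n) set" where
  "real_fields S = {x. \<forall>j. \<forall>h\<in>Lam S j. coef S x j (- h) = cnj (coef S x j h)}"

definition F_en :: "('s::finite, 'm::finite, 'd::finite, 'n::finite) sh_data
    \<Rightarrow> complex ^ 'n \<Rightarrow> real" where
  "F_en S x = Re (F_cx S x)"

definition E_en :: "('s::finite, 'm::finite, 'd::finite, 'n::finite) sh_data
    \<Rightarrow> complex ^ 'n \<Rightarrow> real" where
  "E_en S x = F_en S x + (\<Sum>j\<in>UNIV. G_en S j x)"

definition rationally_independent_columns :: "real ^ 'm::finite ^ 'd::finite \<Rightarrow> bool" where
  "rationally_independent_columns P \<longleftrightarrow>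
     (\<forall>c :: 'm \<Rightarrow> rat. (\<Sum>l\<in>UNIV. of_rat (c l) *\<^sub>R column l P) = 0 \<longrightarrow> (\<forall>l. c l = 0))"

text \<open>
  Coercivity is required on the vectors representing real-valued order parameters. On all of
  \<open>complex ^ 'n\<close> it would be unsatisfiable, \<open>F_en\<close> being the real part of a holomorphic polynomial.
\<close>

definition sh_model :: "('s::finite, 'm::finite, 'd::finite, 'n::finite) sh_data \<Rightarrow> bool" where
  "sh_model S \<longleftrightarrow>
     CARD('d) \<le> CARD('m) \<and>
     rationally_independent_columns (sh_P S) \<and>
     invertible (sh_B S) \<and>
     (\<forall>j. sh_q S j > 0) \<and>
     (\<forall>j l. even (sh_N S j l)) \<and>
     bij_betw (sh_idx S) UNIV (SIGMA j:UNIV. Lam S j) \<and>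
     sh_n S \<le> 4 \<and>
     filterlim (F_en S) at_top (inf at_infinity (principal (real_fields S)))"

subsection \<open>Mass conservation, gradients and critical points\<close>

definition feasible :: "('s::finite, 'm::finite, 'd::finite, 'n::finite) sh_data
    \<Rightarrow> (complex ^ 'n) set" where
  "feasible S = {x. \<forall>j. coef S x j 0 = 0}"

definition mass_proj :: "('s::finite, 'm::finite, 'd::finite, 'n::finite) sh_data
    \<Rightarrow> complex ^ 'n \<Rightarrow> complex ^ 'n" where
  "mass_proj S x = (\<chi> p. if snd (sh_idx S p) = 0 then 0 else x $ p)"

definition grad :: "('a::real_inner \<Rightarrow> real) \<Rightarrow> 'a \<Rightarrow> 'a" where
  "grad f x = (THE g. GDERIV f x :> g)"

definition pgrad :: "('s::finite, 'm::finite, 'd::finite, 'n::finite) sh_data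
    \<Rightarrow> 's \<Rightarrow> (complex ^ 'n \<Rightarrow> real) \<Rightarrow> complex ^ 'n \<Rightarrow> complex ^ 'n" where
  "pgrad S j f x = blk S j (grad f x)"

text \<open>
  The energy is minimized over the feasible subspace, so its gradient there is the projection of the
  full gradient: the components at \<open>h = 0\<close> are Lagrange multipliers of the mass constraint and need
  not vanish.
\<close>

definition critical_point :: "('s::finite, 'm::finite, 'd::finite, 'n::finite) sh_data
    \<Rightarrow> complex ^ 'n \<Rightarrow> bool" where
  "critical_point S x \<longleftrightarrow>
     x \<in> feasible S \<and> (\<exists>g. GDERIV (E_en S) x :> g \<and> mass_proj S g = 0)"

section \<open>The AB-BPG-K method\<close>

record ab_params =
  ab_sigma :: real
  ab_eta :: real
  ab_wbar :: real
  ab_mem :: nat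
  ab_shrink :: real
  ab_alpha0 :: real
  ab_amin :: real
  ab_amax :: real
  ab_a :: real
  ab_b :: real

definition ab_admissible :: "ab_params \<Rightarrow> nat \<Rightarrow> bool" where
  "ab_admissible A K \<longleftrightarrow>
     K \<in> {2, 4} \<and>
     ab_sigma A \<ge> ab_eta A \<and> ab_eta A > 0 \<and> ab_wbar A > 0 \<and>
     0 < ab_shrink A \<and> ab_shrink A < 1 \<and>
     ab_alpha0 A > 0 \<and> ab_amin A > 0 \<and> ab_amax A > 0 \<and>
     (K = 4 \<longrightarrow> ab_a A > 0 \<and> ab_b A > 0)"

text \<open>\<open>resolvent S i \<alpha> c y\<close> is \<open>(\<alpha> \<D>\<^sub>i + c I)\<inverse> y\<close> on block \<open>i\<close>.\<close>

definition resolvent :: "('s::finite, 'm::finite, 'd::finite, 'n::finite) sh_data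
    \<Rightarrow> 's \<Rightarrow> real \<Rightarrow> real \<Rightarrow> complex ^ 'n \<Rightarrow> complex ^ 'n" where
  "resolvent S i \<alpha> c y =
     (\<chi> p. if fst (sh_idx S p) = i
            then y $ p / of_real (\<alpha> * Dentry S i (snd (sh_idx S p)) + c) else 0)"

definition h_quartic :: "ab_params \<Rightarrow> 'a::real_inner \<Rightarrow> real" where
  "h_quartic A x = ab_a A / 4 * norm x ^ 4 + ab_b A / 2 * (norm x)\<^sup>2 + 1"

text \<open>\<open>bpg_map S A K i x \<psi> \<alpha>\<close> is \<open>z(\<alpha>)\<close> at current iterate \<open>x\<close>, block \<open>i\<close>, extrapolated block \<open>\<psi>\<close>.\<close>

definition bpg_map :: "('s::finite, 'm::finite, 'd::finite, 'n::finite) sh_data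
    \<Rightarrow> ab_params \<Rightarrow> nat \<Rightarrow> 's \<Rightarrow> complex ^ 'n \<Rightarrow> complex ^ 'n \<Rightarrow> real \<Rightarrow> complex ^ 'n" where
  "bpg_map S A K i x \<psi> \<alpha> =
     (let f = \<alpha> *\<^sub>R mass_proj S (pgrad S i (F_en S) (upd S i \<psi> x)) in
      if K = 2 then resolvent S i \<alpha> 1 (\<psi> - f)
      else
        let y = grad (h_quartic A) \<psi> - f;
            p = (THE p. p = (norm (resolvent S i \<alpha> (ab_a A * p + ab_b A) y))\<^sup>2)
        in resolvent S i \<alpha> (ab_a A * p + ab_b A) y)"

text \<open>
  Backtracking from the initial value \<open>\<beta>\<close>, where \<open>Q\<close> is the maximal energy in the memory window. If
  the trial step sizes drop below the minimal one before the test succeeds (or \<open>\<beta>\<close> is already below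
  it, as for a nonpositive Barzilai--Borwein value), the step size is the minimal one.
\<close>

definition ls_ok :: "('s::finite, 'm::finite, 'd::finite, 'n::finite) sh_data
    \<Rightarrow> ab_params \<Rightarrow> nat \<Rightarrow> 's \<Rightarrow> complex ^ 'n \<Rightarrow> complex ^ 'n \<Rightarrow> real \<Rightarrow> real \<Rightarrow> bool" where
  "ls_ok S A K i x \<psi> Q \<alpha> \<longleftrightarrow>
     \<alpha> \<ge> ab_amin A \<and>
     (let z = bpg_map S A K i x \<psi> \<alpha> in
        max (E_en S (upd S i \<psi> x)) Q - E_en S (upd S i z x) \<ge> ab_eta A * (norm (\<psi> - z))\<^sup>2)"

definition ls_step :: "('s::finite, 'm::finite, 'd::finite, 'n::finite) sh_data
    \<Rightarrow> ab_params \<Rightarrow> nat \<Rightarrow> 's \<Rightarrow> complex ^ 'n \<Rightarrow> complex ^ 'n \<Rightarrow> real \<Rightarrow> real \<Rightarrow> real" where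
  "ls_step S A K i x \<psi> Q \<beta> =
     (if \<exists>l. ls_ok S A K i x \<psi> Q (ab_shrink A ^ l * \<beta>)
      then max (min (ab_shrink A ^ (LEAST l. ls_ok S A K i x \<psi> Q (ab_shrink A ^ l * \<beta>)) * \<beta>)
                    (ab_amax A)) (ab_amin A)
      else ab_amin A)"

definition init_step :: "('s::finite, 'm::finite, 'd::finite, 'n::finite) sh_data
    \<Rightarrow> ab_params \<Rightarrow> 's \<Rightarrow> complex ^ 'n \<Rightarrow> complex ^ 'n \<Rightarrow> real \<Rightarrow> real set" where
  "init_step S A i x \<psi> w =
     (if w = 0 then {ab_alpha0 A}
      else
        let u = \<psi> - blk S i x;
            v = pgrad S i (F_en S) (upd S i \<psi> x) - pgrad S i (F_en S) x
        in {(u \<bullet> u) / (u \<bullet> v), (v \<bullet> u) / (v \<bullet> v)})"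

text \<open>
  The data of a run: the iterates, the chosen blocks, the extrapolation weights, the nonmonotone
  reference indices \<open>m\<^sub>k\<close>, the initial and final step sizes, and \<open>ab_prev\<close>, whose block \<open>i\<close> at time \<open>k\<close>
  is the value of block \<open>i\<close> before its most recent update (its initial value if there was none).
\<close>

record ('s, 'n) ab_run =
  ab_iter :: "nat \<Rightarrow> complex ^ 'n::finite"
  ab_sel :: "nat \<Rightarrow> 's"
  ab_w :: "nat \<Rightarrow> real"
  ab_ref :: "nat \<Rightarrow> nat"
  ab_init :: "nat \<Rightarrow> real"
  ab_step :: "nat \<Rightarrow> real"
  ab_prev :: "nat \<Rightarrow> complex ^ 'n"

definition extrap :: "('s::finite, 'm::finite, 'd::finite, 'n::finite) sh_data
    \<Rightarrow> ('s, 'n) ab_run \<Rightarrow> nat \<Rightarrow> complex ^ 'n" where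
  "extrap S R k =
     (1 + ab_w R k) *\<^sub>R blk S (ab_sel R k) (ab_iter R k)
       - ab_w R k *\<^sub>R blk S (ab_sel R k) (ab_prev R k)"

definition ab_trial :: "('s::finite, 'm::finite, 'd::finite, 'n::finite) sh_data
    \<Rightarrow> ab_params \<Rightarrow> nat \<Rightarrow> ('s, 'n) ab_run \<Rightarrow> nat \<Rightarrow> complex ^ 'n" where
  "ab_trial S A K R k =
     bpg_map S A K (ab_sel R k) (ab_iter R k) (extrap S R k) (ab_step R k)"

definition ab_accept :: "('s::finite, 'm::finite, 'd::finite, 'n::finite) sh_data
    \<Rightarrow> ab_params \<Rightarrow> nat \<Rightarrow> ('s, 'n) ab_run \<Rightarrow> nat \<Rightarrow> bool" where
  "ab_accept S A K R k \<longleftrightarrow>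
     E_en S (ab_iter R (ab_ref R k))
       - E_en S (upd S (ab_sel R k) (ab_trial S A K R k) (ab_iter R k))
     \<ge> ab_sigma A * (norm (blk S (ab_sel R k) (ab_iter R k) - ab_trial S A K R k))\<^sup>2"

definition AB_BPG :: "('s::finite, 'm::finite, 'd::finite, 'n::finite) sh_data
    \<Rightarrow> ab_params \<Rightarrow> nat \<Rightarrow> ('s, 'n) ab_run \<Rightarrow> bool" where
  "AB_BPG S A K R \<longleftrightarrow>
     ab_iter R 0 \<in> feasible S \<and> ab_iter R 0 \<in> real_fields S \<and>
     ab_prev R 0 = ab_iter R 0 \<and> ab_w R 0 = 0 \<and>
     (\<forall>k.
        is_arg_max (\<lambda>j. E_en S (ab_iter R j)) (\<lambda>j. j \<in> {k - ab_mem A..k}) (ab_ref R k) \<and>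
        ab_init R k \<in> init_step S A (ab_sel R k) (ab_iter R k) (extrap S R k) (ab_w R k) \<and>
        ab_step R k = ls_step S A K (ab_sel R k) (ab_iter R k) (extrap S R k)
                        (E_en S (ab_iter R (ab_ref R k))) (ab_init R k) \<and>
        (if ab_accept S A K R k then
           ab_iter R (Suc k) = upd S (ab_sel R k) (ab_trial S A K R k) (ab_iter R k) \<and>
           ab_prev R (Suc k) = upd S (ab_sel R k) (ab_iter R k) (ab_prev R k) \<and>
           ab_w R (Suc k) \<in> {0..ab_wbar A}
         else
           ab_iter R (Suc k) = ab_iter R k \<and>
           ab_prev R (Suc k) = ab_prev R k \<and>
           ab_w R (Suc k) = 0))"

text \<open>
  Every block is \<^emph>\<open>updated\<close>, not merely selected, in each window: an iteration that ends in a restart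
  leaves the block unchanged and does not count. (If it did, a run that is restarted forever at
  a noncritical initial point would be allowed, which happens for large \<open>\<sigma>\<close>.)
\<close>

definition block_rule :: "('s::finite, 'm::finite, 'd::finite, 'n::finite) sh_data
    \<Rightarrow> ab_params \<Rightarrow> nat \<Rightarrow> ('s, 'n) ab_run \<Rightarrow> nat \<Rightarrow> bool" where
  "block_rule S A K R T \<longleftrightarrow>
     CARD('s) \<le> T \<and> (\<forall>k. \<forall>i. \<exists>j\<in>{k..k + T}. ab_sel R j = i \<and> ab_accept S A K R j)"

section \<open>Reality of the interaction energy\<close>

lemma uminus_Lam: "h \<in> Lam S j \<Longrightarrow> - h \<in> Lam S j"
  by (simp add: Lam_def)

lemma uminus_freqs:
  assumes "H \<in> freqs S i"
  shows "(\<lambda>p\<in>slots i. - H p) \<in> freqs S i"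
  using assms by (force simp: freqs_def PiE_iff sum_negf intro: uminus_Lam)

lemma freqs_Lam: "H \<in> freqs S i \<Longrightarrow> k \<in> {1..i j} \<Longrightarrow> H (j, k) \<in> Lam S j"
  by (auto simp: freqs_def PiE_iff slots_def)

lemma F_cx_real:
  assumes "x \<in> real_fields S"
  shows "F_cx S x \<in> \<real>"
proof -
  have "cnj (\<Sum>H\<in>freqs S i. \<Prod>j\<in>UNIV. \<Prod>k=1..i j. coef S x j (H (j, k)))
      = (\<Sum>H\<in>freqs S i. \<Prod>j\<in>UNIV. \<Prod>k=1..i j. coef S x j (H (j, k)))" for i
  proof -
    have "cnj (\<Sum>H\<in>freqs S i. \<Prod>j\<in>UNIV. \<Prod>k=1..i j. coef S x j (H (j, k)))
        = (\<Sum>H\<in>freqs S i. \<Prod>j\<in>UNIV. \<Prod>k=1..i j. coef S x j (- H (j, k)))"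
      unfolding cnj_sum cnj_prod
    proof (intro sum.cong prod.cong refl)
      fix H j k assume "H \<in> freqs S i" "k \<in> {1..i j}"
      then show "cnj (coef S x j (H (j, k))) = coef S x j (- H (j, k))"
        using assms freqs_Lam[of H S i k j] by (simp add: real_fields_def)
    qed
    also have "\<dots> = (\<Sum>H\<in>freqs S i. \<Prod>j\<in>UNIV. \<Prod>k=1..i j. coef S x j (H (j, k)))"
    proof (rule sum.reindex_bij_witness
        [where i = "\<lambda>H. \<lambda>p\<in>slots i. - H p" and j = "\<lambda>H. \<lambda>p\<in>slots i. - H p"])
      fix H assume H: "H \<in> freqs S i"
      then have "H \<in> extensional (slots i)"
        by (auto simp: freqs_def PiE_iff)
      then show "(\<lambda>p\<in>slots i. - (\<lambda>p\<in>slots i. - H p) p) = H"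
        and "(\<lambda>p\<in>slots i. - (\<lambda>p\<in>slots i. - H p) p) = H"
        by (auto simp: fun_eq_iff extensional_def)
      show "(\<lambda>p\<in>slots i. - H p) \<in> freqs S i" "(\<lambda>p\<in>slots i. - H p) \<in> freqs S i"
        using H by (rule uminus_freqs)+
      show "(\<Prod>j\<in>UNIV. \<Prod>k=1..i j. coef S x j ((\<lambda>p\<in>slots i. - H p) (j, k)))
          = (\<Prod>j\<in>UNIV. \<Prod>k=1..i j. coef S x j (- H (j, k)))"
        by (auto simp: slots_def intro!: prod.cong)
    qed
    finally show ?thesis .
  qed
  then show ?thesis
    unfolding F_cx_def Reals_cnj_iff cnj_sum[of _ "{i. _ i}"] complex_cnj_mult
      complex_cnj_complex_of_real by simp
qed

end

theory Submission
  imports Defs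
begin

text \<open>
  The line search is nonmonotone, but the maximal energy over the memory window decreases. On a
  bounded sequence the energy is uniformly continuous, and the classical argument of Grippo,
  Lampariello and Lucidi shows that successive iterates approach each other. The iterates are
  bounded by coercivity, since they all represent real fields of energy at most the initial one.

  Near a limit point, every block \<open>i\<close> has an accepted update within boundedly many iterations, and so
  has the update that produced \<open>ab_prev\<close>. Hence the current block, the extrapolated block \<open>\<psi>\<close> and the
  trial block \<open>z\<close> all converge to block \<open>i\<close> of the limit. The equation defining \<open>z\<close> reads
  \<open>\<alpha> (\<nabla>F(\<psi>, x\<^bsub>\<noteq>i\<^esub>) + \<D>\<^sub>i z) = \<nabla>h(\<psi>) - \<nabla>h(z)\<close> at all nonzero
  frequencies; its right-hand side tends to zero and the step sizes \<open>\<alpha>\<close> are bounded below, so \<open>\<nabla>F + \<D>\<^sub>i x\<close> vanishes there in the limit.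
\<close>

section \<open>Nonmonotone descent\<close>

lemma nonmonotone_descent_dist_tendsto_0:
  fixes X :: "nat \<Rightarrow> 'a::metric_space" and f :: "'a \<Rightarrow> real"
  assumes uc: "uniformly_continuous_on (range X) f"
    and bdd: "\<And>k. c \<le> f (X k)"
    and ref: "\<And>k. is_arg_max (\<lambda>j. f (X j)) (\<lambda>j. j \<in> {k - M..k}) (m k)"
    and desc: "\<And>k. \<sigma> * (dist (X (Suc k)) (X k))\<^sup>2 \<le> f (X (m k)) - f (X (Suc k))"
    and \<sigma>: "\<sigma> > 0"
  shows "(\<lambda>k. dist (X (Suc k)) (X k)) \<longlonglongrightarrow> 0"
proof -
  define Q where "Q k = f (X (m k))" for k
  have m: "m k \<in> {k - M..k}" and Q_ge: "j \<in> {k - M..k} \<Longrightarrow> f (X j) \<le> Q k" for j k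
    using ref[of k] by (auto simp: is_arg_max_linorder Q_def)
  have desc': "f (X (Suc k)) \<le> Q k" for k
  proof -
    have "0 \<le> \<sigma> * (dist (X (Suc k)) (X k))\<^sup>2" using \<sigma> by simp
    then show ?thesis using desc[of k] by (simp add: Q_def)
  qed
  have "Q (Suc k) \<le> Q k" for k
  proof (cases "m (Suc k) = Suc k")
    case True
    then show ?thesis using desc'[of k] by (simp add: Q_def)
  next
    case False
    then have "m (Suc k) \<in> {k - M..k}" using m[of "Suc k"] by auto
    then show ?thesis using Q_ge[of "m (Suc k)" k] by (simp add: Q_def)
  qed
  then have "decseq Q" by (simp add: decseq_Suc_iff)
  moreover have "\<forall>k. c \<le> Q k" using bdd by (simp add: Q_def)
  ultimately obtain L where L: "Q \<longlonglongrightarrow> L"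
    by (rule decseq_convergent)
  have step: "(\<lambda>k. dist (X (Suc (n k))) (X (n k))) \<longlonglongrightarrow> 0"
    if n: "filterlim n sequentially sequentially" and lim: "(\<lambda>k. f (X (Suc (n k)))) \<longlonglongrightarrow> L"
    for n :: "nat \<Rightarrow> nat"
  proof -
    have "(\<lambda>k. (Q (n k) - f (X (Suc (n k)))) / \<sigma>) \<longlonglongrightarrow> (L - L) / \<sigma>"
      by (intro tendsto_intros filterlim_compose[OF L n] lim) (use \<sigma> in auto)
    then have gap: "(\<lambda>k. (Q (n k) - f (X (Suc (n k)))) / \<sigma>) \<longlonglongrightarrow> 0" by simp
    have "(dist (X (Suc k)) (X k))\<^sup>2 \<le> (Q k - f (X (Suc k))) / \<sigma>" for k
      using desc[of k] \<sigma> by (simp add: Q_def field_simps)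
    then have "(\<lambda>k. (dist (X (Suc (n k))) (X (n k)))\<^sup>2) \<longlonglongrightarrow> 0"
      by (intro Lim_null_comparison[OF always_eventually gap]) simp
    from tendsto_real_sqrt[OF this] show ?thesis by simp
  qed
  have shift: "(\<lambda>k. f (X (m k - l))) \<longlonglongrightarrow> L" for l
  proof (induction l)
    case 0
    then show ?case using L by (simp add: Q_def[abs_def])
  next
    case (Suc l)
    define n where "n k = m k - Suc l" for k
    have n: "filterlim n sequentially sequentially"
    proof (rule filterlim_at_top_mono[where f = "\<lambda>k. k - (M + Suc l)"])
      show "filterlim (\<lambda>k. k - (M + Suc l)) sequentially sequentially"
        by (rule filterlim_minus_const_nat_at_top)
      show "\<forall>\<^sub>F k in sequentially. k - (M + Suc l) \<le> n k"
      proof (intro always_eventually allI)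
        fix k
        show "k - (M + Suc l) \<le> n k" using m[of k] by (simp add: n_def) linarith
      qed
    qed
    have ev: "\<forall>\<^sub>F k in sequentially. m k - l = Suc (n k)"
      using eventually_ge_at_top[of "M + Suc l"]
    proof eventually_elim
      case (elim k)
      then show ?case using m[of k] by (auto simp: n_def)
    qed
    have lim: "(\<lambda>k. f (X (Suc (n k)))) \<longlonglongrightarrow> L"
      by (rule Lim_transform_eventually[OF Suc.IH]) (use ev in eventually_elim, simp)
    have "(\<lambda>k. dist (f (X (Suc (n k)))) (f (X (n k)))) \<longlonglongrightarrow> 0"
      using uniformly_continuous_on_sequentially[THEN iffD1, OF uc, rule_format,
          of "\<lambda>k. X (Suc (n k))" "\<lambda>k. X (n k)"] step[OF n lim] by simp
    then have "(\<lambda>k. f (X (Suc (n k))) - f (X (n k))) \<longlonglongrightarrow> 0"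
      by (simp add: dist_real_def tendsto_rabs_zero_iff)
    from tendsto_diff[OF lim this] show ?case by (simp add: n_def)
  qed
  have "(\<lambda>k. f (X k)) \<longlonglongrightarrow> L"
  proof -
    have mM: "filterlim (\<lambda>k::nat. k + M) sequentially sequentially"
      by (rule filterlim_add_const_nat_at_top)
    have "(\<lambda>k. \<Sum>l\<le>M. \<bar>f (X (m (k + M) - l)) - L\<bar>) \<longlonglongrightarrow> (\<Sum>l\<le>M. \<bar>L - L\<bar>)"
      by (intro tendsto_intros filterlim_compose[OF shift mM])
    then have lim: "(\<lambda>k. \<Sum>l\<le>M. \<bar>f (X (m (k + M) - l)) - L\<bar>) \<longlonglongrightarrow> 0" by simp
    have "norm (f (X k) - L) \<le> (\<Sum>l\<le>M. \<bar>f (X (m (k + M) - l)) - L\<bar>)" for k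
    proof -
      have *: "m (k + M) - k \<in> {..M}" and "k \<le> m (k + M)"
        using m[of "k + M"] by auto
      then show ?thesis
        using member_le_sum[OF *, of "\<lambda>l. \<bar>f (X (m (k + M) - l)) - L\<bar>"] by simp
    qed
    then have "(\<lambda>k. f (X k) - L) \<longlonglongrightarrow> 0"
      by (intro Lim_null_comparison[OF always_eventually lim]) simp
    then show ?thesis by (simp add: LIM_zero_iff)
  qed
  then show ?thesis
    by (intro step filterlim_ident LIMSEQ_Suc[of "\<lambda>k. f (X k)"])
qed

lemma dist_window_tendsto_0:
  fixes X :: "nat \<Rightarrow> 'a::metric_space"
  assumes "(\<lambda>k. dist (X (Suc k)) (X k)) \<longlonglongrightarrow> 0"
    and r: "filterlim r sequentially sequentially"
    and a: "\<And>k. a k \<in> {r k..r k + N}"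
  shows "(\<lambda>k. dist (X (a k)) (X (r k))) \<longlonglongrightarrow> 0"
proof -
  have bound: "dist (X (k + l)) (X k) \<le> (\<Sum>i<l. dist (X (Suc (k + i))) (X (k + i)))" for k l
  proof (induction l)
    case (Suc l)
    then show ?case
      using dist_triangle[of "X (Suc (k + l))" "X k" "X (k + l)"] by simp
  qed simp
  have "(\<lambda>k. dist (X (Suc (r k + i))) (X (r k + i))) \<longlonglongrightarrow> 0" for i
    by (rule filterlim_compose[OF assms(1)])
      (rule filterlim_at_top_mono[OF r], auto)
  then have "(\<lambda>k. \<Sum>i<N. dist (X (Suc (r k + i))) (X (r k + i))) \<longlonglongrightarrow> (\<Sum>i<N. 0)"
    by (intro tendsto_sum)
  then have lim: "(\<lambda>k. \<Sum>i<N. dist (X (Suc (r k + i))) (X (r k + i))) \<longlonglongrightarrow> 0" by simp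
  have "dist (X (a k)) (X (r k)) \<le> (\<Sum>i<N. dist (X (Suc (r k + i))) (X (r k + i)))" for k
  proof -
    have "a k = r k + (a k - r k)" "a k - r k \<le> N" using a[of k] by auto
    then have "dist (X (a k)) (X (r k))
        \<le> (\<Sum>i<a k - r k. dist (X (Suc (r k + i))) (X (r k + i)))"
      using bound[of "r k" "a k - r k"] by simp
    also have "\<dots> \<le> (\<Sum>i<N. dist (X (Suc (r k + i))) (X (r k + i)))"
      using \<open>a k - r k \<le> N\<close> by (intro sum_mono2) auto
    finally show ?thesis .
  qed
  then show ?thesis
    by (intro Lim_null_comparison[OF always_eventually lim]) simp
qed

section \<open>Smoothness of the energy\<close>

text \<open>
  In finite dimension, continuity of every directional derivative is the same as continuity of the
  derivative.
\<close>

definition C1_complex :: "('a::real_normed_vector \<Rightarrow> complex) \<Rightarrow> bool" where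
  "C1_complex f \<longleftrightarrow> (\<exists>D. (\<forall>x. (f has_derivative D x) (at x)) \<and> (\<forall>v. continuous_on UNIV (\<lambda>x. D x v)))"

lemma C1_complex_continuous:
  assumes "C1_complex f" shows "continuous_on UNIV f"
proof -
  have "isCont f x" for x
    using assms has_derivative_continuous[of f _ x UNIV] unfolding C1_complex_def by blast
  then show ?thesis by (simp add: continuous_on_eq_continuous_at)
qed

lemma C1_complex_const: "C1_complex (\<lambda>x. c)"
  unfolding C1_complex_def by (rule exI[of _ "\<lambda>x v. 0"]) (auto intro!: derivative_eq_intros)

lemma C1_complex_nth: "C1_complex (\<lambda>x :: complex ^ 'n. x $ p)"
  unfolding C1_complex_def
  by (rule exI[of _ "\<lambda>x v. v $ p"])
    (auto intro!: bounded_linear_imp_has_derivative bounded_linear_vec_nth continuous_intros)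

lemma C1_complex_sum:
  assumes "\<And>i. i \<in> I \<Longrightarrow> C1_complex (f i)"
  shows "C1_complex (\<lambda>x. \<Sum>i\<in>I. f i x)"
proof -
  from assms obtain D where "\<And>i x. i \<in> I \<Longrightarrow> (f i has_derivative D i x) (at x)"
    "\<And>i v. i \<in> I \<Longrightarrow> continuous_on UNIV (\<lambda>x. D i x v)"
    unfolding C1_complex_def by metis
  then show ?thesis
    unfolding C1_complex_def
    by (intro exI[of _ "\<lambda>x v. \<Sum>i\<in>I. D i x v"]) (auto intro!: derivative_intros continuous_intros)
qed

lemma C1_complex_mult:
  assumes "C1_complex f" "C1_complex g"
  shows "C1_complex (\<lambda>x. f x * g x)"
proof -
  note assms(1,2)[THEN C1_complex_continuous]
  moreover from assms obtain D E where "\<And>x. (f has_derivative D x) (at x)"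
    "\<And>v. continuous_on UNIV (\<lambda>x. D x v)" "\<And>x. (g has_derivative E x) (at x)"
    "\<And>v. continuous_on UNIV (\<lambda>x. E x v)"
    unfolding C1_complex_def by metis
  ultimately show ?thesis
    unfolding C1_complex_def
    by (intro exI[of _ "\<lambda>x v. f x * E x v + D x v * g x"])
      (auto intro!: has_derivative_mult continuous_intros)
qed

lemma C1_complex_prod:
  "(\<And>i. i \<in> I \<Longrightarrow> C1_complex (f i)) \<Longrightarrow> C1_complex (\<lambda>x. \<Prod>i\<in>I. f i x)"
  by (induction I rule: infinite_finite_induct)
    (auto intro: C1_complex_const C1_complex_mult)

lemma C1_complex_F_cx: "C1_complex (F_cx S)"
  unfolding F_cx_def[abs_def] coef_def
  by (intro C1_complex_sum C1_complex_mult C1_complex_const C1_complex_prod C1_complex_nth)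

lemma GDERIV_unique: "GDERIV f x :> g \<Longrightarrow> GDERIV f x :> g' \<Longrightarrow> g = g'"
  unfolding gderiv_def
  by (drule (1) has_derivative_unique) (metis (no_types) inner_commute vector_eq_rdot)

lemma grad_eq: "GDERIV f x :> g \<Longrightarrow> grad f x = g"
  unfolding grad_def by (blast intro: GDERIV_unique)

lemma
  shows GDERIV_F_en: "GDERIV (F_en S) x :> grad (F_en S) x"
    and continuous_grad_F_en: "continuous_on UNIV (grad (F_en S))"
proof -
  obtain D where D: "\<And>x. (F_cx S has_derivative D x) (at x)"
    and cont: "\<And>v. continuous_on UNIV (\<lambda>x. D x v)"
    using C1_complex_F_cx[of S] unfolding C1_complex_def by metis
  define g where "g x = (\<Sum>b\<in>Basis. Re (D x b) *\<^sub>R b)" for x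
  have G: "GDERIV (F_en S) x :> g x" for x
  proof -
    have lin: "bounded_linear (\<lambda>v. Re (D x v))"
      by (intro bounded_linear_compose[OF bounded_linear_Re] has_derivative_bounded_linear[OF D])
    have "v \<bullet> g x = Re (D x v)" for v
    proof -
      have "Re (D x v) = Re (D x (\<Sum>b\<in>Basis. (v \<bullet> b) *\<^sub>R b))"
        by (simp only: euclidean_representation)
      also have "\<dots> = (\<Sum>b\<in>Basis. (v \<bullet> b) * Re (D x b))"
        by (simp add: linear_sum[OF bounded_linear.linear[OF lin]]
            linear_cmul[OF bounded_linear.linear[OF lin]])
      finally show ?thesis
        by (simp add: g_def inner_sum_right mult.commute)
    qed
    moreover have "(F_en S has_derivative (\<lambda>v. Re (D x v))) (at x)"
      unfolding F_en_def[abs_def]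
      by (rule bounded_linear.has_derivative[OF bounded_linear_Re D])
    ultimately show ?thesis by (simp add: gderiv_def)
  qed
  then have "grad (F_en S) = g" by (auto simp: grad_eq)
  moreover have "continuous_on UNIV g"
    unfolding g_def[abs_def] by (intro continuous_intros cont)
  ultimately show "GDERIV (F_en S) x :> grad (F_en S) x" "continuous_on UNIV (grad (F_en S))"
    using G by auto
qed

lemma GDERIV_G_en: "GDERIV (G_en S j) x :> Dop S j x"
proof -
  have blk: "bounded_linear (blk S j)" and Dop: "bounded_linear (Dop S j)"
    unfolding linear_conv_bounded_linear[symmetric]
    by (auto simp: blk_def Dop_def vec_eq_iff algebra_simps intro!: linearI)
  have "(G_en S j has_derivative
      (\<lambda>v. (blk S j x \<bullet> Dop S j (blk S j v) + blk S j v \<bullet> Dop S j (blk S j x)) / 2)) (at x)"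
    unfolding G_en_def[abs_def]
    by (intro bounded_linear.has_derivative[OF bounded_linear_divide] has_derivative_inner
        bounded_linear.has_derivative[OF Dop] bounded_linear_imp_has_derivative[OF blk])
  moreover have "blk S j x \<bullet> Dop S j (blk S j v) = v \<bullet> Dop S j x"
    "blk S j v \<bullet> Dop S j (blk S j x) = v \<bullet> Dop S j x" for v
    by (auto simp: inner_vec_def blk_def Dop_def inner_complex_def algebra_simps intro!: sum.cong)
  ultimately show ?thesis by (simp add: gderiv_def)
qed

lemma Dentry_nonneg: "Dentry S j h \<ge> 0"
  by (simp add: Dentry_def Let_def)

lemma G_en_nonneg: "G_en S j x \<ge> 0"
proof -
  have "0 \<le> t * (Dentry S j h * t)" for t h
    using Dentry_nonneg[of S j h] by (simp add: mult.left_commute[of t])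
  then show ?thesis
    unfolding G_en_def
    by (auto simp: inner_vec_def blk_def Dop_def inner_complex_def
        intro!: sum_nonneg add_nonneg_nonneg)
qed

lemma GDERIV_E_en: "GDERIV (E_en S) x :> grad (F_en S) x + (\<Sum>j\<in>UNIV. Dop S j x)"
proof -
  have "(E_en S has_derivative (\<lambda>h. h \<bullet> grad (F_en S) x + (\<Sum>j\<in>UNIV. h \<bullet> Dop S j x))) (at x)"
    unfolding E_en_def[abs_def] using GDERIV_F_en GDERIV_G_en
    by (intro has_derivative_add has_derivative_sum) (auto simp: gderiv_def)
  then show ?thesis by (simp add: gderiv_def inner_add_right inner_sum_right)
qed

lemma continuous_E_en: "continuous_on UNIV (E_en S)"
  using GDERIV_E_en[of S] has_derivative_continuous[of "E_en S" _ _ UNIV]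
  by (auto simp: continuous_on_eq_continuous_at gderiv_def)

lemma grad_h_quartic: "grad (h_quartic A) x = (ab_a A * (norm x)\<^sup>2 + ab_b A) *\<^sub>R x"
proof (rule grad_eq)
  have eq: "h_quartic A = (\<lambda>x. ab_a A / 4 * (x \<bullet> x)\<^sup>2 + ab_b A / 2 * (x \<bullet> x) + 1)"
    by (auto simp: h_quartic_def fun_eq_iff power2_norm_eq_inner[symmetric])
  show "GDERIV (h_quartic A) x :> (ab_a A * (norm x)\<^sup>2 + ab_b A) *\<^sub>R x"
    unfolding eq gderiv_def
    by (auto intro!: derivative_eq_intros simp: fun_eq_iff power2_norm_eq_inner inner_commute algebra_simps)
qed

section \<open>Reality of the gradient\<close>

lemma Dentry_uminus:
  fixes h :: "int ^ 'm::finite"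
  shows "Dentry S j (- h) = Dentry S j h"
proof -
  have "(\<chi> l. of_int ((- h) $ l)) = - ((\<chi> l. of_int (h $ l)) :: real ^ 'm)"
    by (simp add: vec_eq_iff)
  then have "sh_P S *v (sh_B S *v (\<chi> l. of_int ((- h) $ l)))
      = - (sh_P S *v (sh_B S *v (\<chi> l. of_int (h $ l))))"
    by (simp add: linear_neg[OF matrix_vector_mul_linear])
  then show ?thesis by (simp only: Dentry_def Let_def inner_minus_left inner_minus_right minus_minus)
qed

text \<open>
  \<open>refl_idx\<close> is \<open>(j, h) \<mapsto> (j, - h)\<close>, read through the enumeration. The real-linear isometry
  \<open>conj_refl\<close> has the vectors of \<open>real_fields\<close> as its fixed points and leaves \<open>F_en\<close> invariant, so
  it commutes with the gradient.
\<close>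

definition refl_idx :: "('s::finite, 'm::finite, 'd::finite, 'n::finite) sh_data \<Rightarrow> 'n \<Rightarrow> 'n" where
  "refl_idx S p = inv (sh_idx S) (fst (sh_idx S p), - snd (sh_idx S p))"

definition conj_refl :: "('s::finite, 'm::finite, 'd::finite, 'n::finite) sh_data
    \<Rightarrow> complex ^ 'n \<Rightarrow> complex ^ 'n" where
  "conj_refl S x = (\<chi> p. cnj (x $ refl_idx S p))"

context
  fixes S :: "('s::finite, 'm::finite, 'd::finite, 'n::finite) sh_data"
  assumes idx: "bij_betw (sh_idx S) UNIV (SIGMA j:UNIV. Lam S j)"
begin

lemma idx_inv: "h \<in> Lam S j \<Longrightarrow> sh_idx S (inv (sh_idx S) (j, h)) = (j, h)"
  using bij_betw_imp_surj_on[OF idx] by (intro f_inv_into_f) simp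

lemma inv_idx: "inv (sh_idx S) (sh_idx S p) = p"
  by (rule inv_f_f[OF bij_betw_imp_inj_on[OF idx]])

lemma idx_Lam: "snd (sh_idx S p) \<in> Lam S (fst (sh_idx S p))"
proof -
  have "sh_idx S p \<in> (SIGMA j:UNIV. Lam S j)"
    using bij_betw_imp_surj_on[OF idx] by blast
  then show ?thesis by (metis SigmaD2 prod.collapse)
qed

lemma idx_refl_idx: "sh_idx S (refl_idx S p) = (fst (sh_idx S p), - snd (sh_idx S p))"
  by (simp add: refl_idx_def idx_inv uminus_Lam idx_Lam)

lemma refl_idx_refl_idx: "refl_idx S (refl_idx S p) = p"
  by (simp add: refl_idx_def[of S "refl_idx S p"] idx_refl_idx inv_idx)

lemma feasible_iff: "x \<in> feasible S \<longleftrightarrow> (\<forall>p. snd (sh_idx S p) = 0 \<longrightarrow> x $ p = 0)"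
proof -
  have "0 \<in> Lam S j" for j by (simp add: Lam_def)
  then have "snd (sh_idx S p) = 0 \<longleftrightarrow> (\<exists>j. p = inv (sh_idx S) (j, 0))" for p
    using inv_idx[of p] idx_inv[of 0] by (cases "sh_idx S p") auto
  then show ?thesis
    unfolding feasible_def coef_def by auto
qed

lemma real_fields_iff: "x \<in> real_fields S \<longleftrightarrow> (\<forall>p. x $ refl_idx S p = cnj (x $ p))"
proof -
  have "x \<in> real_fields S \<longleftrightarrow> (\<forall>q\<in>(SIGMA j:UNIV. Lam S j).
      coef S x (fst q) (- snd q) = cnj (coef S x (fst q) (snd q)))"
    by (auto simp: real_fields_def)
  also have "(SIGMA j:UNIV. Lam S j) = range (sh_idx S)"
    using idx by (simp add: bij_betw_def)
  finally show ?thesis by (simp add: coef_def inv_idx refl_idx_def)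
qed

lemma conj_refl_eq_iff: "conj_refl S x = x \<longleftrightarrow> x \<in> real_fields S"
  by (simp add: real_fields_iff conj_refl_def vec_eq_iff complex_cnj_cancel_iff[symmetric, of "_ $ refl_idx S _"])

lemma coef_conj_refl: "h \<in> Lam S j \<Longrightarrow> coef S (conj_refl S x) j h = cnj (coef S x j (- h))"
  by (simp add: coef_def conj_refl_def refl_idx_def idx_inv)

lemma F_cx_conj_refl: "F_cx S (conj_refl S x) = cnj (F_cx S x)"
proof -
  have "(\<Sum>H\<in>freqs S i. \<Prod>j\<in>UNIV. \<Prod>k=1..i j. coef S (conj_refl S x) j (H (j, k)))
      = (\<Sum>H\<in>freqs S i. \<Prod>j\<in>UNIV. \<Prod>k=1..i j. cnj (coef S x j (H (j, k))))" for i
  proof (rule sum.reindex_bij_witness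
        [where i = "\<lambda>H. \<lambda>p\<in>slots i. - H p" and j = "\<lambda>H. \<lambda>p\<in>slots i. - H p"])
    fix H assume H: "H \<in> freqs S i"
    then have "H \<in> extensional (slots i)"
      by (auto simp: freqs_def PiE_iff)
    then show "(\<lambda>p\<in>slots i. - (\<lambda>p\<in>slots i. - H p) p) = H"
      and "(\<lambda>p\<in>slots i. - (\<lambda>p\<in>slots i. - H p) p) = H"
      by (auto simp: fun_eq_iff extensional_def)
    show "(\<lambda>p\<in>slots i. - H p) \<in> freqs S i" "(\<lambda>p\<in>slots i. - H p) \<in> freqs S i"
      using H by (rule uminus_freqs)+
    show "(\<Prod>j\<in>UNIV. \<Prod>k=1..i j. cnj (coef S x j ((\<lambda>p\<in>slots i. - H p) (j, k))))
        = (\<Prod>j\<in>UNIV. \<Prod>k=1..i j. coef S (conj_refl S x) j (H (j, k)))"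
      using freqs_Lam[OF H] by (auto simp: slots_def coef_conj_refl intro!: prod.cong)
  qed
  then show ?thesis by (simp add: F_cx_def)
qed

lemma conj_refl_inner: "conj_refl S v \<bullet> w = v \<bullet> conj_refl S w"
  unfolding inner_vec_def
  by (rule sum.reindex_bij_witness[where i = "refl_idx S" and j = "refl_idx S"])
    (auto simp: conj_refl_def refl_idx_refl_idx inner_complex_def)

lemma grad_F_en_real_fields:
  assumes "x \<in> real_fields S"
  shows "grad (F_en S) x \<in> real_fields S"
proof -
  have lin: "bounded_linear (conj_refl S)"
    unfolding linear_conv_bounded_linear[symmetric]
    by (rule linearI) (auto simp: conj_refl_def vec_eq_iff)
  have "(F_en S has_derivative (\<lambda>v. v \<bullet> grad (F_en S) x)) (at (conj_refl S x))"
    using GDERIV_F_en[of S x] assms by (simp add: gderiv_def flip: conj_refl_eq_iff)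
  from has_derivative_compose[OF bounded_linear_imp_has_derivative[OF lin] this]
  have "((\<lambda>x. F_en S (conj_refl S x)) has_derivative (\<lambda>v. v \<bullet> conj_refl S (grad (F_en S) x))) (at x)"
    by (simp add: conj_refl_inner)
  moreover have "(\<lambda>x. F_en S (conj_refl S x)) = F_en S"
    by (simp add: fun_eq_iff F_en_def F_cx_conj_refl)
  ultimately have "GDERIV (F_en S) x :> conj_refl S (grad (F_en S) x)"
    by (simp add: gderiv_def)
  then have "conj_refl S (grad (F_en S) x) = grad (F_en S) x"
    using GDERIV_F_en by (rule GDERIV_unique)
  then show ?thesis by (simp only: conj_refl_eq_iff)
qed

end

section \<open>The proximal step\<close>

lemma ex1_quartic_fixpoint:
  assumes "a > 0" "b > 0" "\<alpha> \<ge> 0"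
  shows "\<exists>!p. p = (norm (resolvent S i \<alpha> (a * p + b) y))\<^sup>2"
proof -
  define f where "f p = (norm (resolvent S i \<alpha> (a * p + b) y))\<^sup>2" for p
  have pos: "\<alpha> * Dentry S i h + (a * p + b) > 0" if "p \<ge> 0" for p h
    using assms that Dentry_nonneg[of S i h] by (simp add: add_nonneg_pos)
  have anti: "f q \<le> f p" if "0 \<le> p" "p \<le> q" for p q
    unfolding f_def
  proof (intro power_mono norm_le_componentwise_cart norm_ge_zero)
    fix n
    have "norm (y $ n) / (\<alpha> * Dentry S i h + (a * q + b))
        \<le> norm (y $ n) / (\<alpha> * Dentry S i h + (a * p + b))" for h
      using pos[of p h] that assms by (intro divide_left_mono mult_pos_pos pos) auto
    then show "norm (resolvent S i \<alpha> (a * q + b) y $ n) \<le> norm (resolvent S i \<alpha> (a * p + b) y $ n)"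
      using pos[of p] pos[of q] that
      by (simp add: resolvent_def norm_divide del: of_real_add of_real_mult) (smt (verit, best))
  qed
  have cont: "continuous_on {0..f 0} (\<lambda>p. p - f p)"
  proof -
    have nz: "of_real (\<alpha> * Dentry S i h + (a * p + b)) \<noteq> (0 :: complex)" if "0 \<le> p" for p h
      using pos[OF that, of h] by (metis less_irrefl of_real_eq_0_iff)
    have "continuous_on {0..f 0} (\<lambda>p. resolvent S i \<alpha> (a * p + b) y $ n)" for n
    proof (cases "fst (sh_idx S n) = i")
      case True
      have "continuous_on {0..f 0}
          (\<lambda>p. y $ n / of_real (\<alpha> * Dentry S i (snd (sh_idx S n)) + (a * p + b)))"
        by (intro continuous_intros ballI nz) simp
      then show ?thesis using True by (simp add: resolvent_def)
    qed (simp add: resolvent_def)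
    then have "continuous_on {0..f 0} (\<lambda>p. \<chi> n. resolvent S i \<alpha> (a * p + b) y $ n)"
      by (rule continuous_on_vec_lambda)
    then have "continuous_on {0..f 0} (\<lambda>p. resolvent S i \<alpha> (a * p + b) y)"
      by simp
    then show ?thesis
      unfolding f_def by (intro continuous_intros)
  qed
  have f0: "f 0 \<ge> 0" by (simp add: f_def)
  have "\<exists>p\<ge>0. p \<le> f 0 \<and> p - f p = 0"
    using cont f0 anti[of 0 "f 0"] by (intro IVT') auto
  moreover have "p = q" if "p = f p" "q = f q" for p q
  proof -
    have "0 \<le> p" "0 \<le> q" using that f_def by (metis zero_le_power2)+
    then show ?thesis using anti[of p q] anti[of q p] that by linarith
  qed
  ultimately show ?thesis unfolding f_def[symmetric] by (metis (no_types, lifting) eq_iff_diff_eq_0)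
qed

text \<open>
  The factor in \<open>\<nabla>h(x) = kernel_weight A K x *\<^sub>R x\<close>, where \<open>h(x) = \<parallel>x\<parallel>\<^sup>2 / 2\<close> for \<open>K = 2\<close> and \<open>h\<close> is
  the quartic kernel for \<open>K = 4\<close>; both variants of the step then solve the same implicit equation.
\<close>

definition kernel_weight :: "ab_params \<Rightarrow> nat \<Rightarrow> 'a::real_normed_vector \<Rightarrow> real" where
  "kernel_weight A K x = (if K = 2 then 1 else ab_a A * (norm x)\<^sup>2 + ab_b A)"

lemma kernel_weight_pos: "ab_admissible A K \<Longrightarrow> kernel_weight A K x > 0"
  by (auto simp: ab_admissible_def kernel_weight_def add_nonneg_pos)

lemma bpg_map_eq:
  assumes "ab_admissible A K" "\<alpha> \<ge> 0" and z: "z = bpg_map S A K i x \<psi> \<alpha>"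
  shows "z = resolvent S i \<alpha> (kernel_weight A K z)
    (kernel_weight A K \<psi> *\<^sub>R \<psi> - \<alpha> *\<^sub>R mass_proj S (pgrad S i (F_en S) (upd S i \<psi> x)))"
proof (cases "K = 2")
  case True
  then show ?thesis using z by (simp add: bpg_map_def kernel_weight_def Let_def)
next
  case False
  then have "ab_a A > 0" "ab_b A > 0" using assms(1) by (auto simp: ab_admissible_def)
  define y where "y = kernel_weight A K \<psi> *\<^sub>R \<psi>
    - \<alpha> *\<^sub>R mass_proj S (pgrad S i (F_en S) (upd S i \<psi> x))"
  define p where "p = (THE p. p = (norm (resolvent S i \<alpha> (ab_a A * p + ab_b A) y))\<^sup>2)"
  have p: "p = (norm (resolvent S i \<alpha> (ab_a A * p + ab_b A) y))\<^sup>2"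
    unfolding p_def
    by (rule theI', rule ex1_quartic_fixpoint) fact+
  have z': "z = resolvent S i \<alpha> (ab_a A * p + ab_b A) y"
    using False by (simp add: z bpg_map_def Let_def grad_h_quartic y_def p_def kernel_weight_def)
  then have "kernel_weight A K z = ab_a A * p + ab_b A"
    using p False by (simp add: kernel_weight_def)
  then show ?thesis unfolding y_def[symmetric] using z' by simp
qed

lemma bpg_map_nth:
  assumes "ab_admissible A K" "\<alpha> \<ge> 0" and z: "z = bpg_map S A K i x \<psi> \<alpha>"
    and p: "fst (sh_idx S p) = i" "snd (sh_idx S p) \<noteq> 0"
  shows "\<alpha> *\<^sub>R (grad (F_en S) (upd S i \<psi> x) $ p + Dentry S i (snd (sh_idx S p)) *\<^sub>R z $ p)
    = kernel_weight A K \<psi> *\<^sub>R \<psi> $ p - kernel_weight A K z *\<^sub>R z $ p"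
proof -
  define D where "D = \<alpha> * Dentry S i (snd (sh_idx S p)) + kernel_weight A K z"
  have "D > 0"
    using kernel_weight_pos[OF assms(1), of z] assms(2) Dentry_nonneg[of S i "snd (sh_idx S p)"]
    by (simp add: D_def add_nonneg_pos)
  have "z $ p = (kernel_weight A K \<psi> *\<^sub>R \<psi> $ p - \<alpha> *\<^sub>R grad (F_en S) (upd S i \<psi> x) $ p) / of_real D"
    by (subst bpg_map_eq[OF assms(1-3)])
      (simp add: resolvent_def p mass_proj_def pgrad_def blk_def D_def)
  then have "D *\<^sub>R z $ p = kernel_weight A K \<psi> *\<^sub>R \<psi> $ p - \<alpha> *\<^sub>R grad (F_en S) (upd S i \<psi> x) $ p"
    using \<open>D > 0\<close> by (simp add: scaleR_conv_of_real[of D])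
  then show ?thesis by (simp add: D_def algebra_simps)
qed

lemma bpg_map_off_block:
  "ab_admissible A K \<Longrightarrow> \<alpha> \<ge> 0 \<Longrightarrow> fst (sh_idx S p) \<noteq> i \<Longrightarrow> bpg_map S A K i x \<psi> \<alpha> $ p = 0"
  by (subst bpg_map_eq[OF _ _ refl]) (simp_all add: resolvent_def)

lemma upd_nth: "upd S i u x $ p = (if fst (sh_idx S p) = i then u $ p else x $ p)"
  by (simp add: upd_def)

lemma blk_nth: "blk S i x $ p = (if fst (sh_idx S p) = i then x $ p else 0)"
  by (simp add: blk_def)

lemma dist_upd:
  assumes "\<And>p. fst (sh_idx S p) \<noteq> i \<Longrightarrow> z $ p = 0"
  shows "dist (upd S i z x) x = norm (blk S i x - z)"
proof -
  have "upd S i z x - x = - (blk S i x - z)"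
    using assms by (auto simp: vec_eq_iff upd_nth blk_nth)
  then show ?thesis by (metis dist_norm norm_minus_cancel)
qed

lemma ls_step_ge: "ls_step S A K i x \<psi> Q \<beta> \<ge> ab_amin A"
  by (simp add: ls_step_def)

lemma real_fields_coercive:
  assumes "sh_model S"
  obtains B where "\<And>x. x \<in> real_fields S \<Longrightarrow> E_en S x \<le> c \<Longrightarrow> norm x < B"
proof -
  have "\<forall>\<^sub>F x in inf at_infinity (principal (real_fields S)). c < F_en S x"
    using assms unfolding sh_model_def filterlim_at_top_dense by blast
  then obtain B where "\<And>x. B \<le> norm x \<Longrightarrow> x \<in> real_fields S \<Longrightarrow> c < F_en S x"
    by (auto simp: eventually_inf_principal eventually_at_infinity)
  moreover have "F_en S x \<le> E_en S x" for x
    by (simp add: E_en_def sum_nonneg G_en_nonneg)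
  ultimately show ?thesis
    by (intro that[of B]) (meson leI leD order.trans)
qed

section \<open>Runs of the method\<close>

context
  fixes S :: "('s::finite, 'm::finite, 'd::finite, 'n::finite) sh_data"
    and A :: ab_params and K :: nat and R :: "('s, 'n) ab_run"
  assumes idx: "bij_betw (sh_idx S) UNIV (SIGMA j:UNIV. Lam S j)"
    and params: "ab_admissible A K"
    and run: "AB_BPG S A K R"
begin

lemma bpg_map_invariant:
  assumes "x \<in> feasible S \<inter> real_fields S" "\<psi> \<in> feasible S \<inter> real_fields S" "\<alpha> \<ge> 0"
  shows "bpg_map S A K i x \<psi> \<alpha> \<in> feasible S \<inter> real_fields S"
proof -
  have "upd S i \<psi> x \<in> real_fields S"
    using assms by (auto simp: real_fields_iff[OF idx] upd_nth idx_refl_idx[OF idx])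
  then have "grad (F_en S) (upd S i \<psi> x) \<in> real_fields S"
    by (rule grad_F_en_real_fields[OF idx])
  then show ?thesis
    using assms
    by (subst bpg_map_eq[OF params _ refl])
      (auto simp: real_fields_iff[OF idx] feasible_iff[OF idx] resolvent_def mass_proj_def
        pgrad_def blk_nth idx_refl_idx[OF idx] Dentry_uminus)
qed

lemma step_ge: "ab_step R k \<ge> ab_amin A"
  using run by (simp add: AB_BPG_def ls_step_ge)

lemma step_pos: "ab_step R k > 0"
  using step_ge[of k] params by (auto simp: ab_admissible_def)

lemma accepted:
  assumes "ab_accept S A K R k"
  shows "ab_iter R (Suc k) = upd S (ab_sel R k) (ab_trial S A K R k) (ab_iter R k)"
    and "ab_prev R (Suc k) = upd S (ab_sel R k) (ab_iter R k) (ab_prev R k)"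
  using run assms by (simp_all add: AB_BPG_def)

lemma rejected:
  assumes "\<not> ab_accept S A K R k"
  shows "ab_iter R (Suc k) = ab_iter R k" and "ab_prev R (Suc k) = ab_prev R k"
  using run assms by (simp_all add: AB_BPG_def)

lemma weight_bounds: "ab_w R k \<in> {0..ab_wbar A}"
proof (cases k)
  case 0
  then show ?thesis using run params by (simp add: AB_BPG_def ab_admissible_def)
next
  case (Suc l)
  have "0 \<le> ab_wbar A" using params by (simp add: ab_admissible_def)
  then show ?thesis
    using run unfolding Suc AB_BPG_def
    by (cases "ab_accept S A K R l") (simp_all del: atLeastAtMost_iff, simp)
qed

lemma iter_prev_invariant:
  "ab_iter R k \<in> feasible S \<inter> real_fields S \<and> ab_prev R k \<in> feasible S \<inter> real_fields S"
proof (induction k)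
  case 0
  then show ?case using run by (simp add: AB_BPG_def)
next
  case (Suc k)
  show ?case
  proof (cases "ab_accept S A K R k")
    case True
    have "extrap S R k \<in> feasible S \<inter> real_fields S"
      using Suc by (auto simp: extrap_def feasible_iff[OF idx] real_fields_iff[OF idx] blk_nth
          idx_refl_idx[OF idx])
    then have "ab_trial S A K R k \<in> feasible S \<inter> real_fields S"
      unfolding ab_trial_def using Suc step_pos[of k] by (intro bpg_map_invariant) auto
    then show ?thesis
      using Suc by (auto simp: accepted[OF True] feasible_iff[OF idx] real_fields_iff[OF idx]
          upd_nth idx_refl_idx[OF idx])
  qed (use Suc in \<open>simp add: rejected\<close>)
qed

lemma trial_off_block: "fst (sh_idx S p) \<noteq> ab_sel R k \<Longrightarrow> ab_trial S A K R k $ p = 0"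
  unfolding ab_trial_def using step_pos[of k] by (intro bpg_map_off_block[OF params]) auto

lemma ref_max:
  "is_arg_max (\<lambda>j. E_en S (ab_iter R j)) (\<lambda>j. j \<in> {k - ab_mem A..k}) (ab_ref R k)"
  using run by (simp add: AB_BPG_def)

lemma sufficient_decrease:
  "ab_sigma A * (dist (ab_iter R (Suc k)) (ab_iter R k))\<^sup>2
    \<le> E_en S (ab_iter R (ab_ref R k)) - E_en S (ab_iter R (Suc k))"
proof (cases "ab_accept S A K R k")
  case True
  then show ?thesis
    by (simp add: accepted dist_upd trial_off_block) (simp add: ab_accept_def)
next
  case False
  have "E_en S (ab_iter R k) \<le> E_en S (ab_iter R (ab_ref R k))"
    using ref_max[of k] by (auto simp: is_arg_max_linorder)
  then show ?thesis using False by (simp add: rejected)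
qed

lemma sigma_pos: "ab_sigma A > 0"
  using params by (auto simp: ab_admissible_def)

lemma energy_le_initial: "E_en S (ab_iter R k) \<le> E_en S (ab_iter R 0)"
proof (induction k rule: less_induct)
  case (less k)
  show ?case
  proof (cases k)
    case (Suc l)
    have "0 \<le> ab_sigma A * (dist (ab_iter R (Suc l)) (ab_iter R l))\<^sup>2"
      using sigma_pos by simp
    moreover have "ab_ref R l < k"
      using ref_max[of l] Suc by (auto simp: is_arg_max_def)
    ultimately show ?thesis
      using sufficient_decrease[of l] less[of "ab_ref R l"] Suc by simp
  qed simp
qed

lemma successive_dist_tendsto_0:
  assumes "bounded (range (ab_iter R))"
  shows "(\<lambda>k. dist (ab_iter R (Suc k)) (ab_iter R k)) \<longlonglongrightarrow> 0"
proof -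
  define C where "C = closure (range (ab_iter R))"
  have C: "compact C" "range (ab_iter R) \<subseteq> C"
    using assms by (auto simp: C_def compact_closure closure_subset)
  have cont: "continuous_on C (E_en S)"
    using continuous_on_subset[OF continuous_E_en] by blast
  have "uniformly_continuous_on (range (ab_iter R)) (E_en S)"
    using compact_uniformly_continuous[OF cont C(1)] C(2)
    unfolding uniformly_continuous_on_def by (meson subsetD)
  moreover have "bounded (E_en S ` C)"
    by (intro compact_imp_bounded compact_continuous_image cont C)
  then obtain c where "\<And>x. x \<in> C \<Longrightarrow> \<bar>E_en S x\<bar> \<le> c"
    by (auto simp: bounded_iff)
  then have "- c \<le> E_en S (ab_iter R k)" for k
    using C(2) abs_le_D2[of "E_en S (ab_iter R k)" c] by (simp add: image_subset_iff)
  ultimately show ?thesis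
    using ref_max sufficient_decrease sigma_pos by (rule nonmonotone_descent_dist_tendsto_0)
qed

lemma prev_block:
  assumes "t < j" "ab_sel R t = i" "ab_accept S A K R t"
  shows "\<exists>t'\<in>{t..<j}. blk S i (ab_prev R j) = blk S i (ab_iter R t')"
  using assms(1)
proof (induction j)
  case (Suc j)
  show ?case
  proof (cases "ab_sel R j = i \<and> ab_accept S A K R j")
    case True
    then have "blk S i (ab_prev R (Suc j)) = blk S i (ab_iter R j)"
      by (simp add: accepted vec_eq_iff blk_nth upd_nth)
    then show ?thesis using Suc.prems by (intro bexI[of _ j]) auto
  next
    case False
    then have "t < j" using assms(2,3) Suc.prems by (metis less_SucE)
    moreover have "blk S i (ab_prev R (Suc j)) = blk S i (ab_prev R j)"
      using False
      by (cases "ab_accept S A K R j") (auto simp: accepted rejected vec_eq_iff blk_nth upd_nth)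
    ultimately show ?thesis using Suc.IH by fastforce
  qed
qed simp

lemma limit_point_stationary:
  assumes blocks: "block_rule S A K R T"
    and bdd: "bounded (range (ab_iter R))"
    and r: "strict_mono r" and lim: "(ab_iter R \<circ> r) \<longlonglongrightarrow> x"
    and p: "snd (sh_idx S p) \<noteq> 0"
  shows "grad (F_en S) x $ p
    + Dentry S (fst (sh_idx S p)) (snd (sh_idx S p)) *\<^sub>R x $ p = 0"
proof -
  define i where "i = fst (sh_idx S p)"
  define d where "d = Dentry S i (snd (sh_idx S p))"
  have rule: "\<exists>j\<in>{k..k + T}. ab_sel R j = i \<and> ab_accept S A K R j" for k
    using blocks by (simp add: block_rule_def)
  have "\<exists>j t. j \<in> {r k..r k + (2 * T + 1)} \<and> t \<in> {r k..r k + (2 * T + 2)} \<and>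
      ab_sel R j = i \<and> ab_accept S A K R j \<and> blk S i (ab_prev R j) = blk S i (ab_iter R t)" for k
  proof -
    obtain t where t: "t \<in> {r k..r k + T}" "ab_sel R t = i" "ab_accept S A K R t"
      using rule by blast
    obtain j where j: "j \<in> {r k + T + 1..r k + T + 1 + T}" "ab_sel R j = i" "ab_accept S A K R j"
      using rule by blast
    have "t < j" using t(1) j(1) by simp
    from prev_block[OF this t(2,3)] obtain t' where
      "t' \<in> {t..<j}" "blk S i (ab_prev R j) = blk S i (ab_iter R t')" by blast
    then show ?thesis using t j by (intro exI[of _ j] exI[of _ t']) auto
  qed
  then obtain j t where j: "\<And>k. j k \<in> {r k..r k + (2 * T + 1)}"
    and t: "\<And>k. t k \<in> {r k..r k + (2 * T + 2)}"
    and sel: "\<And>k. ab_sel R (j k) = i" and acc: "\<And>k. ab_accept S A K R (j k)"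
    and prev: "\<And>k. blk S i (ab_prev R (j k)) = blk S i (ab_iter R (t k))"
    by metis
  have near: "(\<lambda>k. ab_iter R (a k)) \<longlonglongrightarrow> x"
    if "\<And>k. a k \<in> {r k..r k + (2 * T + 2)}" for a
  proof -
    have "(\<lambda>k. dist (ab_iter R (a k)) (ab_iter R (r k))) \<longlonglongrightarrow> 0"
      using successive_dist_tendsto_0[OF bdd] filterlim_subseq[OF r] that
      by (rule dist_window_tendsto_0)
    then have "(\<lambda>k. ab_iter R (a k) - ab_iter R (r k)) \<longlonglongrightarrow> 0"
      by (simp add: dist_norm tendsto_norm_zero_iff)
    from tendsto_add[OF this lim[unfolded comp_def]] show ?thesis by simp
  qed
  have "j k \<in> {r k..r k + (2 * T + 2)}" for k
    using j[of k] by simp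
  then have lim_j: "(\<lambda>k. ab_iter R (j k)) \<longlonglongrightarrow> x"
    by (rule near)
  have "Suc (j k) \<in> {r k..r k + (2 * T + 2)}" for k
    using j[of k] by simp
  then have lim_Suc: "(\<lambda>k. ab_iter R (Suc (j k))) \<longlonglongrightarrow> x"
    by (rule near)
  have lim_t: "(\<lambda>k. ab_iter R (t k)) \<longlonglongrightarrow> x"
    using t by (rule near)
  have blk_lim: "(\<lambda>k. blk S i (X k)) \<longlonglongrightarrow> blk S i x" if "X \<longlonglongrightarrow> x" for X
  proof (rule vec_tendstoI)
    fix q
    show "(\<lambda>k. blk S i (X k) $ q) \<longlonglongrightarrow> blk S i x $ q"
      using tendsto_vec_nth[OF that, of q] by (simp add: blk_nth)
  qed
  define \<psi> where "\<psi> k = extrap S R (j k)" for k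
  define z where "z k = ab_trial S A K R (j k)" for k
  have z_eq: "z k = blk S i (ab_iter R (Suc (j k)))" for k
    using trial_off_block[of _ "j k"]
    by (auto simp: z_def accepted[OF acc] sel vec_eq_iff blk_nth upd_nth)
  have z_lim: "z \<longlonglongrightarrow> blk S i x"
    unfolding z_eq[abs_def] by (rule blk_lim[OF lim_Suc])
  have \<psi>_lim: "\<psi> \<longlonglongrightarrow> blk S i x"
  proof -
    define e where "e k = blk S i (ab_iter R (j k)) - blk S i (ab_iter R (t k))" for k
    have "e \<longlonglongrightarrow> blk S i x - blk S i x"
      unfolding e_def[abs_def] by (intro tendsto_diff blk_lim lim_j lim_t)
    then have e_lim: "(\<lambda>k. ab_wbar A * norm (e k)) \<longlonglongrightarrow> 0"
      by (intro tendsto_mult_right_zero tendsto_norm_zero) simp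
    have "norm (ab_w R (j k) *\<^sub>R e k) \<le> ab_wbar A * norm (e k)" for k
      using weight_bounds[of "j k"] by (auto intro: mult_right_mono)
    then have "(\<lambda>k. ab_w R (j k) *\<^sub>R e k) \<longlonglongrightarrow> 0"
      by (intro Lim_null_comparison[OF always_eventually e_lim]) blast
    from tendsto_add[OF blk_lim[OF lim_j] this]
    have "(\<lambda>k. blk S i (ab_iter R (j k)) + ab_w R (j k) *\<^sub>R e k) \<longlonglongrightarrow> blk S i x"
      by simp
    moreover have "\<psi> k = blk S i (ab_iter R (j k)) + ab_w R (j k) *\<^sub>R e k" for k
      by (simp add: \<psi>_def extrap_def sel prev e_def algebra_simps)
    then have "\<psi> = (\<lambda>k. blk S i (ab_iter R (j k)) + ab_w R (j k) *\<^sub>R e k)" ..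
    ultimately show ?thesis by simp
  qed
  define y where "y k = upd S i (\<psi> k) (ab_iter R (j k))" for k
  have "y \<longlonglongrightarrow> x"
  proof (rule vec_tendstoI)
    fix q
    show "(\<lambda>k. y k $ q) \<longlonglongrightarrow> x $ q"
      using tendsto_vec_nth[OF \<psi>_lim, of q] tendsto_vec_nth[OF lim_j, of q]
      by (cases "fst (sh_idx S q) = i") (simp_all add: y_def upd_nth blk_nth)
  qed
  then have grad_lim: "(\<lambda>k. grad (F_en S) (y k)) \<longlonglongrightarrow> grad (F_en S) x"
    by (rule continuous_on_tendsto_compose[OF continuous_grad_F_en]) auto
  define g where "g k = grad (F_en S) (y k) $ p + d *\<^sub>R z k $ p" for k
  have z_p: "(\<lambda>k. z k $ p) \<longlonglongrightarrow> x $ p"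
    using tendsto_vec_nth[OF z_lim, of p] by (simp add: blk_nth i_def)
  have "g \<longlonglongrightarrow> grad (F_en S) x $ p + d *\<^sub>R x $ p"
    unfolding g_def[abs_def]
    by (intro tendsto_add tendsto_scaleR tendsto_const tendsto_vec_nth[OF grad_lim] z_p)
  moreover have "g \<longlonglongrightarrow> 0"
  proof -
    define h where "h k = kernel_weight A K (\<psi> k) *\<^sub>R \<psi> k $ p
      - kernel_weight A K (z k) *\<^sub>R z k $ p" for k
    have step_g: "ab_step R (j k) *\<^sub>R g k = h k" for k
      unfolding g_def h_def y_def d_def
      using step_pos[of "j k"] p
      by (intro bpg_map_nth[OF params]) (auto simp: z_def ab_trial_def sel \<psi>_def i_def)
    have kw: "(\<lambda>k. kernel_weight A K (X k)) \<longlonglongrightarrow> kernel_weight A K u"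
      if "X \<longlonglongrightarrow> u" for X and u :: "complex ^ 'n"
      unfolding kernel_weight_def by (cases "K = 2") (auto intro!: tendsto_intros that)
    have "h \<longlonglongrightarrow> kernel_weight A K (blk S i x) *\<^sub>R blk S i x $ p
        - kernel_weight A K (blk S i x) *\<^sub>R blk S i x $ p"
      unfolding h_def[abs_def] by (intro tendsto_intros kw \<psi>_lim z_lim)
    then have h_lim: "(\<lambda>k. norm (h k) / ab_amin A) \<longlonglongrightarrow> 0"
      by (intro tendsto_divide_zero tendsto_norm_zero) simp
    have "norm (g k) \<le> norm (h k) / ab_amin A" for k
    proof -
      have amin: "ab_amin A > 0" using params by (simp add: ab_admissible_def)
      have "ab_amin A * norm (g k) \<le> ab_step R (j k) * norm (g k)"
        using step_ge by (rule mult_right_mono) simp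
      also have "\<dots> = norm (h k)"
        using step_pos[of "j k"] by (simp flip: step_g)
      finally show ?thesis using amin by (simp add: field_simps)
    qed
    then show ?thesis
      by (intro Lim_null_comparison[OF always_eventually h_lim]) blast
  qed
  ultimately show ?thesis
    unfolding d_def i_def by (rule LIMSEQ_unique)
qed

end

theorem theorem6:
  fixes S :: "('s::finite, 'm::finite, 'd::finite, 'n::finite) sh_data"
    and A :: ab_params
    and R :: "('s, 'n) ab_run"
    and K T :: nat
    and x :: "complex ^ 'n"
  assumes model: "sh_model S"
    and params: "ab_admissible A K"
    and run: "AB_BPG S A K R"
    and blocks: "block_rule S A K R T"
    and cond: "(K = 2 \<and> bounded (range (ab_iter R))) \<or> K = 4"
    and limit_point: "\<exists>r :: nat \<Rightarrow> nat. strict_mono r \<and> (ab_iter R \<circ> r) \<longlonglongrightarrow> x"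
  shows "critical_point S x"
proof -
  have idx: "bij_betw (sh_idx S) UNIV (SIGMA j:UNIV. Lam S j)"
    using model by (simp add: sh_model_def)
  note inv = iter_prev_invariant[OF idx params run]
  have bdd: "bounded (range (ab_iter R))"
  proof -
    obtain B where "\<And>x. x \<in> real_fields S \<Longrightarrow> E_en S x \<le> E_en S (ab_iter R 0) \<Longrightarrow> norm x < B"
      using real_fields_coercive[OF model] by blast
    then have "norm (ab_iter R k) \<le> B" for k
      using inv energy_le_initial[OF idx params run] by (meson IntE less_imp_le)
    then show ?thesis by (auto simp: bounded_iff)
  qed
  obtain r where r: "strict_mono r" "(ab_iter R \<circ> r) \<longlonglongrightarrow> x"
    using limit_point by blast
  have "x $ p = 0" if "snd (sh_idx S p) = 0" for p
  proof -
    have "ab_iter R k $ p = 0" for k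
      using inv that by (auto simp: feasible_iff[OF idx])
    then show ?thesis
      using tendsto_vec_nth[OF r(2), of p] by (simp add: LIMSEQ_const_iff)
  qed
  then have "x \<in> feasible S" by (simp add: feasible_iff[OF idx])
  moreover have "mass_proj S (grad (F_en S) x + (\<Sum>j\<in>UNIV. Dop S j x)) = 0"
    using limit_point_stationary[OF idx params run blocks bdd r]
    by (simp add: mass_proj_def vec_eq_iff Dop_def if_distrib[of "\<lambda>t. t $ _"] scaleR_conv_of_real
        cong: if_cong)
  ultimately show ?thesis
    unfolding critical_point_def using GDERIV_E_en by blast
qed

end
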